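(* Let $P(x)=\sum_{i=0}^n P_i x^i\in\mathbb C[x]^{m\times m}$ be a regular matrix polynomial of degree $n$, let $q$ be an integer with $0<q\le n$, and let $B_1(x),\ldots,B_q(x)$ and $W_1(x),\ldots,W_q(x)$ be matrix polynomials in $\mathbb C[x]^{m\times m}$. Let $C_i(x)=\prod_{j=1,\,j\neq i}^q B_j(x)$ and suppose that the following conditions hold: 1. $P(x)=\prod_{i=1}^q B_i(x)+\sum_{i=1}^q W_i(x)C_i(x)$; 2. the polynomials $B_i(x)$ are regular, commute, i.e., $B_i(x)B_j(x)-B_j(x)B_i(x)=0$ for any $i,j$, and are pairwise right co-prime. Then the $mq\times mq$ matrix polynomial $$A(x)=D(x)+(e\otimes I_m)[W_1(x),\ldots,W_q(x)],\qquad D(x)=\operatorname{diag}(B_1(x),\ldots,B_q(x)),$$ where $e=(1,\ldots,1)^t\in\mathbb C^q$, is equivalent to $P(x)$, i.e., there exist unimodular $mq\times mq$ matrix polynomials $E(x),F(x)$ such that $E(x)A(x)F(x)=I_{m(q-1)}\oplus P(x)$.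
   Context: $\mathbb C[x]^{m\times m}$ is the set of $m\times m$ matrix polynomials over $\mathbb C$; $P(x)=\sum_{i=0}^n P_ix^i$ has degree $n$ if $P_n\ne 0$. A matrix polynomial is regular if its determinant is not identically zero. A square matrix polynomial is unimodular if its determinant is a nonzero constant. Two matrix polynomials $B(x),B'(x)\in\mathbb C[x]^{m\times m}$ are right co-prime if there exist $\alpha(x),\beta(x)\in\mathbb C[x]^{m\times m}$ with $B(x)\alpha(x)+B'(x)\beta(x)=I_m$; "pairwise" refers to all pairs with distinct indices. $\operatorname{diag}(B_1,\ldots,B_q)$ is the block diagonal matrix with these $m\times m$ blocks, and $X\oplus Y$ denotes the block diagonal matrix with blocks $X,Y$. For an integer $0<q\le n$, $Q(x)\in\mathbb C[x]^{qm\times qm}$ is equivalent to $P(x)$ if there are unimodular $E(x),F(x)\in\mathbb C[x]^{qm\times qm}$ with $E(x)Q(x)F(x)=I_{m(q-1)}\oplus P(x)$. *)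

theory Defs
  imports
    Complex_Main
    "Jordan_Normal_Form.Determinant"
begin

text \<open>A matrix polynomial over the complex numbers is a matrix of type
  \<^typ>\<open>complex poly mat\<close>; its size is given by \<^const>\<open>carrier_mat\<close>.\<close>

definition mat_sum :: "nat \<Rightarrow> ('i \<Rightarrow> 'a :: semiring_1 mat) \<Rightarrow> 'i set \<Rightarrow> 'a mat" where
  "mat_sum m f I = finsum (ring_mat TYPE('a) m ()) f I"

text \<open>Matrix products do not commute in general, so the index range is a list, and the
  factors are multiplied from left to right in the order of the list.\<close>

definition mat_prod :: "nat \<Rightarrow> ('i \<Rightarrow> 'a :: semiring_1 mat) \<Rightarrow> 'i list \<Rightarrow> 'a mat" where
  "mat_prod m f is = foldr (*) (map f is) (1\<^sub>m m)"

text \<open>The matrix polynomial with coefficients \<open>Pc 0, \<dots>, Pc n\<close>, that is, the sum of the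
  \<open>Pc i\<close> times \<open>x ^ i\<close>.\<close>

definition mat_poly :: "nat \<Rightarrow> nat \<Rightarrow> (nat \<Rightarrow> complex mat) \<Rightarrow> complex poly mat" where
  "mat_poly m n Pc = mat_sum m (\<lambda>i. monom 1 i \<cdot>\<^sub>m map_mat (\<lambda>c. [:c:]) (Pc i)) {..n}"

definition regular :: "complex poly mat \<Rightarrow> bool" where
  "regular M \<longleftrightarrow> square_mat M \<and> det M \<noteq> 0"

definition unimodular :: "complex poly mat \<Rightarrow> bool" where
  "unimodular M \<longleftrightarrow> square_mat M \<and> (\<exists>c. c \<noteq> 0 \<and> det M = [:c:])"

definition right_coprime :: "nat \<Rightarrow> complex poly mat \<Rightarrow> complex poly mat \<Rightarrow> bool" where
  "right_coprime m B B' \<longleftrightarrow>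
     (\<exists>\<alpha> \<in> carrier_mat m m. \<exists>\<beta> \<in> carrier_mat m m. B * \<alpha> + B' * \<beta> = 1\<^sub>m m)"

text \<open>Kronecker product: block \<open>(i, j)\<close> of the result is \<open>A $$ (i, j)\<close> times \<open>B\<close>.\<close>

definition kronecker :: "'a :: times mat \<Rightarrow> 'a mat \<Rightarrow> 'a mat" (infixl \<open>\<otimes>\<^sub>m\<close> 70) where
  "A \<otimes>\<^sub>m B = mat (dim_row A * dim_row B) (dim_col A * dim_col B)
     (\<lambda>(r, c). A $$ (r div dim_row B, c div dim_col B) * B $$ (r mod dim_row B, c mod dim_col B))"

definition ones_col :: "nat \<Rightarrow> 'a :: {zero,one} mat" where
  "ones_col q = mat q 1 (\<lambda>_. 1)"

text \<open>The block row \<open>[M\<^sub>1, \<dots>, M\<^sub>q]\<close> of matrices with \<open>m\<close> rows.\<close>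

definition block_row :: "nat \<Rightarrow> 'a mat list \<Rightarrow> 'a mat" where
  "block_row m Ms = mat_of_cols m (concat (map cols Ms))"

definition equivalent_mat_poly ::
  "nat \<Rightarrow> nat \<Rightarrow> complex poly mat \<Rightarrow> complex poly mat \<Rightarrow> bool" where
  "equivalent_mat_poly m q Q P \<longleftrightarrow>
     Q \<in> carrier_mat (q * m) (q * m) \<and> P \<in> carrier_mat m m \<and>
     (\<exists>E \<in> carrier_mat (q * m) (q * m). \<exists>F \<in> carrier_mat (q * m) (q * m).
        unimodular E \<and> unimodular F \<and>
        E * Q * F = diag_block_mat [1\<^sub>m (m * (q - 1)), P])"

end

theory Submission
  imports Defs
begin

text \<open>
  Write \<open>A\<close> as a block diagonal matrix \<open>D\<close> plus the block row \<open>[W\<^sub>1, \<dots>, W\<^sub>q]\<close> repeated in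
  every block row. The proof is an induction on \<open>q\<close> which replaces the first two blocks by one:
  \<open>B\<^sub>1, B\<^sub>2\<close> become \<open>B\<^sub>1 B\<^sub>2\<close>, and \<open>W\<^sub>1, W\<^sub>2\<close> become \<open>W\<^sub>1 B\<^sub>2 + W\<^sub>2 B\<^sub>1\<close>. This is what adding the
  two fractions \<open>W\<^sub>1 B\<^sub>1\<^sup>-\<^sup>1 + W\<^sub>2 B\<^sub>2\<^sup>-\<^sup>1\<close> does, so the matrix \<open>P\<close>, which is the numerator of
  \<open>I + \<Sum> W\<^sub>i B\<^sub>i\<^sup>-\<^sup>1\<close>, stays the same (\<open>secular_numerator_merge\<close>). For \<open>q = 1\<close> both \<open>A\<close> and \<open>P\<close>
  are \<open>B\<^sub>1 + W\<^sub>1\<close>.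

  The merging is a unimodular equivalence up to one identity block (\<open>rank_update_merge\<close>).
  Subtracting the second block row from the first leaves \<open>(B\<^sub>1, -B\<^sub>2, 0, \<dots>, 0)\<close> as first row.
  If \<open>B\<^sub>1 \<alpha> + B\<^sub>2 \<beta> = I\<close>, multiplying the first two block columns on the right by
  \<open>(\<alpha>, B\<^sub>2; -\<beta>, B\<^sub>1)\<close> turns this row into \<open>(I, 0, 0, \<dots>, 0)\<close>, since \<open>B\<^sub>1\<close> and \<open>B\<^sub>2\<close> commute, and turns
  the common entries \<open>W\<^sub>1, W\<^sub>2\<close> of the other rows into \<open>W\<^sub>1 B\<^sub>2 + W\<^sub>2 B\<^sub>1\<close> in the second column; the
  diagonal block \<open>B\<^sub>2\<close> becomes \<open>B\<^sub>2 B\<^sub>1\<close>. The identity block then clears the first column below it.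

  The column operation has determinant 1, although \<open>\<alpha>\<close> and \<open>\<beta>\<close> need not commute with
  anything: multiplied on the left by \<open>(B\<^sub>1, -B\<^sub>2; 0, I)\<close> it becomes \<open>(I, 0; -\<beta>, B\<^sub>1)\<close>, and both the
  factor and the product have determinant \<open>det B\<^sub>1\<close>, which can be cancelled because \<open>B\<^sub>1\<close> is
  regular (\<open>det_merging_column_operation\<close>). Finally the merged family is again commuting,
  regular and pairwise right co-prime; the last property is \<open>right_coprime_mult_left\<close>.
\<close>

section \<open>Splitting off an identity block\<close>

text \<open>The two row equations say that left multiplication by the block matrix \<open>(B1, T; 0, I)\<close> makes the
matrix block lower triangular with diagonal blocks \<open>I\<close> and \<open>K\<close>. In the application \<open>\<alpha>\<close> is a Bezout
coefficient, which need not commute with \<open>B1\<close>, so the formula for the determinant of a block matrix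
with commuting blocks does not apply; cancelling \<open>det B1\<close> does the job.\<close>

lemma det_merging_column_operation:
  fixes B1 :: "'a :: idom mat"
  assumes B: "B1 \<in> carrier_mat m m" "T \<in> carrier_mat m N"
    and F: "\<alpha> \<in> carrier_mat m m" "H \<in> carrier_mat m N" "V \<in> carrier_mat N m" "K \<in> carrier_mat N N"
    and row: "B1 * \<alpha> + T * V = 1\<^sub>m m" "B1 * H + T * K = 0\<^sub>m m N"
    and dets: "det K = det B1" "det B1 \<noteq> 0"
  shows "det (four_block_mat \<alpha> H V K) = 1"
proof -
  let ?F = "four_block_mat \<alpha> H V K"
  let ?L = "four_block_mat B1 T (0\<^sub>m N m) (1\<^sub>m N)"
  have "?L * ?F = four_block_mat (1\<^sub>m m) (0\<^sub>m m N) V K"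
    by (subst mult_four_block_mat[where ?n1.0=m and ?n2.0=N]) (use assms in auto)
  then have "det (?L * ?F) = det B1"
    using det_four_block_mat_upper_right_zero[OF one_carrier_mat refl F(3,4)] dets by simp
  moreover have "det (?L * ?F) = det ?L * det ?F"
    by (rule det_mult[of _ "m + N"]) (use assms in auto)
  moreover have "det ?L = det B1"
    using det_four_block_mat_lower_left_zero[OF B refl, of "1\<^sub>m N"] by simp
  ultimately show ?thesis using dets by simp
qed

lemma mult_diag_blocks:
  fixes A :: "'a :: semiring_1 mat"
  assumes "A \<in> carrier_mat N N" "M \<in> carrier_mat N N"
  shows "four_block_mat (1\<^sub>m m) (0\<^sub>m m N) (0\<^sub>m N m) A * four_block_mat (1\<^sub>m m) (0\<^sub>m m N) (0\<^sub>m N m) M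
    = four_block_mat (1\<^sub>m m) (0\<^sub>m m N) (0\<^sub>m N m) (A * M)"
  using assms by (subst mult_four_block_mat[of _ m m _ N _ N]) auto

lemma diag_block_mat_pair:
  assumes "A \<in> carrier_mat k k" "M \<in> carrier_mat m m"
  shows "diag_block_mat [A, M] = four_block_mat A (0\<^sub>m k m) (0\<^sub>m m k) M"
  unfolding diag_block_mat.simps(2)[of A "[M]"] diag_block_mat_singleton Let_def
  using assms by simp

text \<open>Here all blocks but the first are treated as one block \<open>A\<close> of size \<open>N\<close>. In the application \<open>S\<close>
selects the first block row of \<open>A\<close>, \<open>J\<close> is its transpose, and \<open>K\<close> acts as \<open>B1\<close> on the first block
and as the identity on the rest; the listed products are all that the computation uses of them. The hypothesis on \<open>S * A\<close> says that this row of \<open>A\<close> agrees with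
the border row \<open>R\<close> except for the diagonal entry \<open>B2\<close>.\<close>

lemma split_off_identity_block:
  fixes B1 :: "'a :: idom mat"
  assumes car: "B1 \<in> carrier_mat m m" "B2 \<in> carrier_mat m m" "W1 \<in> carrier_mat m m"
      "\<alpha> \<in> carrier_mat m m" "\<beta> \<in> carrier_mat m m"
      "U \<in> carrier_mat N m" "R \<in> carrier_mat m N" "A \<in> carrier_mat N N"
      "S \<in> carrier_mat m N" "J \<in> carrier_mat N m" "K \<in> carrier_mat N N"
    and comm: "B1 * B2 = B2 * B1"
    and bezout: "B1 * \<alpha> + B2 * \<beta> = 1\<^sub>m m"
    and dets: "det K = det B1" "det B1 \<noteq> 0"
    and SU: "S * U = 1\<^sub>m m" and SJ: "S * J = 1\<^sub>m m" and SK: "S * K = B1 * S"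
    and SA: "S * A = B2 * S + R"
  shows "\<exists>E \<in> carrier_mat (m + N) (m + N). \<exists>F \<in> carrier_mat (m + N) (m + N).
    det E = 1 \<and> det F = 1 \<and>
    E * four_block_mat (B1 + W1) R (U * W1) A * F
      = four_block_mat (1\<^sub>m m) (0\<^sub>m m N) (0\<^sub>m N m) (U * W1 * (B2 * S) + A * K)"
proof -
  let ?n = "m + N"
  define T V H X where "T = - (B2 * S)" and "V = - (J * \<beta>)" and "H = B2 * S"
    and "X = U * W1 * \<alpha> + A * V"
  have [simp]: "T \<in> carrier_mat m N" "V \<in> carrier_mat N m" "H \<in> carrier_mat m N"
      "X \<in> carrier_mat N m"
    using car by (auto simp: T_def V_def H_def X_def)
  have [simp]: "dim_row X = N" "dim_col X = m"
    by (rule carrier_matD[OF \<open>X \<in> carrier_mat N m\<close>])+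
  note [simp] = car car[THEN carrier_matD(1)] car[THEN carrier_matD(2)]
  have [simp]: "U * W1 \<in> carrier_mat N m" by (rule mult_carrier_mat[OF car(6) car(3)])
  have [simp]: "U * W1 * H + A * K \<in> carrier_mat N N"
    by (rule add_carrier_mat, rule mult_carrier_mat[OF car(8,11)])
  \<comment> \<open>The column operation \<open>(\<alpha>, H; V, K)\<close> turns the row \<open>(B1, T)\<close> into \<open>(1, 0)\<close>.\<close>
  have "T * V = (B2 * S) * (J * \<beta>)"
    unfolding T_def V_def by simp
  also have "\<dots> = B2 * (S * (J * \<beta>))"
    by (rule assoc_mult_mat) auto
  also have "S * (J * \<beta>) = S * J * \<beta>"
    by (rule assoc_mult_mat[symmetric]) auto
  finally have "T * V = B2 * \<beta>" by (simp add: SJ)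
  then have row1: "B1 * \<alpha> + T * V = 1\<^sub>m m" by (simp add: bezout)
  have "T * K = - (B2 * S * K)" unfolding T_def by simp
  also have "B2 * S * K = B2 * (S * K)" by (rule assoc_mult_mat) auto
  also have "\<dots> = B2 * B1 * S" unfolding SK by (rule assoc_mult_mat[symmetric]) auto
  also have "\<dots> = B1 * H" unfolding H_def comm[symmetric] by (rule assoc_mult_mat) auto
  finally have "T * K = - (B1 * H)" .
  moreover have "Y + - Y = 0\<^sub>m m N" if "Y \<in> carrier_mat m N" for Y :: "'a mat"
    using that by (intro eq_matI) auto
  moreover have "B1 * H \<in> carrier_mat m N" by (rule mult_carrier_mat[of _ m m]) auto
  ultimately have row2: "B1 * H + T * K = 0\<^sub>m m N" by simp
  \<comment> \<open>\<open>E1\<close> creates the row \<open>(B1, T)\<close>, and \<open>E2\<close> clears the column below the new identity block.\<close>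
  define E1 F E2 where "E1 = four_block_mat (1\<^sub>m m) (- S) (0\<^sub>m N m) (1\<^sub>m N)"
    and "F = four_block_mat \<alpha> H V K"
    and "E2 = four_block_mat (1\<^sub>m m) (0\<^sub>m m N) (- X) (1\<^sub>m N)"
  have EF_car: "E1 \<in> carrier_mat ?n ?n" "F \<in> carrier_mat ?n ?n" "E2 \<in> carrier_mat ?n ?n"
    by (auto simp: E1_def F_def E2_def)
  let ?A = "four_block_mat (B1 + W1) R (U * W1) A"
  have A_car: "?A \<in> carrier_mat ?n ?n" by auto
  have "S * (U * W1) = S * U * W1" by (rule assoc_mult_mat[symmetric]) auto
  then have SUW: "S * (U * W1) = W1" by (simp add: SU)
  have e1: "(B1 + W1) + (- S) * (U * W1) = B1"
    by (rule eq_matI) (auto simp: SUW)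
  have e2: "R + (- S) * A = T"
    unfolding T_def
    by (rule eq_matI) (auto simp: SA)
  have E1A: "E1 * ?A = four_block_mat B1 T (U * W1) A"
    unfolding E1_def
    by (subst mult_four_block_mat[where ?n1.0=m and ?n2.0=N]) 
      (auto simp: e1[simplified] e2[simplified])
  have E1AF: "E1 * ?A * F = four_block_mat (1\<^sub>m m) (0\<^sub>m m N) X (U * W1 * H + A * K)"
    unfolding E1A F_def
    by (subst mult_four_block_mat[where ?n1.0=m and ?n2.0=N]) (auto simp: row1 row2 X_def)
  have "E2 * E1 * ?A * F = E2 * (E1 * ?A * F)"
    using EF_car A_car by (simp add: assoc_mult_mat[of _ ?n ?n _ ?n _ ?n])
  also have "\<dots> = four_block_mat (1\<^sub>m m) (0\<^sub>m m N) (0\<^sub>m N m) (U * W1 * H + A * K)"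
    unfolding E1AF E2_def
    by (subst mult_four_block_mat[where ?n1.0=m and ?n2.0=N]) auto
  finally have eq: "E2 * E1 * ?A * F = \<dots>" .
  have "det F = 1"
    unfolding F_def by (rule det_merging_column_operation[OF _ _ _ _ _ _ row1 row2 dets]) auto
  moreover have "det E1 = 1"
    unfolding E1_def by (subst det_four_block_mat_lower_left_zero[of _ m _ N]) auto
  moreover have "det E2 = 1"
    unfolding E2_def by (subst det_four_block_mat_upper_right_zero[of _ m _ N]) auto
  ultimately show ?thesis using eq EF_car det_mult[OF EF_car(3,1)]
    unfolding H_def
    by (intro bexI[of _ "E2 * E1"] bexI[of _ F]) auto
qed

text \<open>The preceding lemma with its second block divided again into the block to be merged and a rest of
size \<open>k\<close>. A block column or block row is written as a four-block matrix with an empty second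
column or row, so that all products are given by the rule for four-block matrices.\<close>

lemma merge_two_blocks:
  fixes B1 :: "'a :: idom mat"
  assumes car: "B1 \<in> carrier_mat m m" "B2 \<in> carrier_mat m m" "W1 \<in> carrier_mat m m"
      "W2 \<in> carrier_mat m m" "\<alpha> \<in> carrier_mat m m" "\<beta> \<in> carrier_mat m m"
      "U \<in> carrier_mat k m" "R \<in> carrier_mat m k" "A \<in> carrier_mat k k"
    and comm: "B1 * B2 = B2 * B1"
    and bezout: "B1 * \<alpha> + B2 * \<beta> = 1\<^sub>m m"
    and det: "det B1 \<noteq> 0"
  defines "U' \<equiv> four_block_mat (1\<^sub>m m) (0\<^sub>m m 0) U (0\<^sub>m k 0)"
    and "R' \<equiv> four_block_mat W2 R (0\<^sub>m 0 m) (0\<^sub>m 0 k)"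
    and "W \<equiv> W1 * B2 + W2 * B1"
  shows "\<exists>E \<in> carrier_mat (m + (m + k)) (m + (m + k)). \<exists>F \<in> carrier_mat (m + (m + k)) (m + (m + k)).
    det E = 1 \<and> det F = 1 \<and>
    E * four_block_mat (B1 + W1) R' (U' * W1) (four_block_mat (B2 + W2) R (U * W2) A) * F
      = four_block_mat (1\<^sub>m m) (0\<^sub>m m (m + k)) (0\<^sub>m (m + k) m)
          (four_block_mat (B1 * B2 + W) R (U * W) A)"
proof -
  note [simp] = car car[THEN carrier_matD(1)] car[THEN carrier_matD(2)]
  define S where "S = four_block_mat (1\<^sub>m m) (0\<^sub>m m k) (0\<^sub>m 0 m) (0\<^sub>m 0 k :: 'a mat)"
  define J where "J = four_block_mat (1\<^sub>m m) (0\<^sub>m m 0) (0\<^sub>m k m) (0\<^sub>m k 0 :: 'a mat)"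
  define K where "K = four_block_mat B1 (0\<^sub>m m k) (0\<^sub>m k m) (1\<^sub>m k)"
  let ?A = "four_block_mat (B2 + W2) R (U * W2) A"
  have fb: "four_block_mat X (0\<^sub>m m 0) (0\<^sub>m 0 m) (0\<^sub>m 0 0) = X"
    if "X \<in> carrier_mat m m" for X :: "'a mat"
    using that by (intro eq_matI) auto
  have m_car: "U' \<in> carrier_mat (m + k) m" "R' \<in> carrier_mat m (m + k)"
    "S \<in> carrier_mat m (m + k)" "J \<in> carrier_mat (m + k) m"
    "K \<in> carrier_mat (m + k) (m + k)" "?A \<in> carrier_mat (m + k) (m + k)"
    using four_block_carrier_mat[of "1\<^sub>m m" m m "0\<^sub>m k 0" k 0 "0\<^sub>m m 0" U]
      four_block_carrier_mat[of W2 m m "0\<^sub>m 0 k" 0 k R "0\<^sub>m 0 m"]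
      four_block_carrier_mat[of "1\<^sub>m m" m m "0\<^sub>m 0 k" 0 k "0\<^sub>m m k" "0\<^sub>m 0 m"]
      four_block_carrier_mat[of "1\<^sub>m m" m m "0\<^sub>m k 0" k 0 "0\<^sub>m m 0" "0\<^sub>m k m"]
    by (auto simp: U'_def R'_def S_def J_def K_def)
  have XS: "X * S = four_block_mat X (0\<^sub>m m k) (0\<^sub>m 0 m) (0\<^sub>m 0 k)"
    if "X \<in> carrier_mat m m" for X
  proof -
    have "X * S = four_block_mat X (0\<^sub>m m 0) (0\<^sub>m 0 m) (0\<^sub>m 0 0) * S" by (simp only: fb[OF that])
    also have "\<dots> = four_block_mat X (0\<^sub>m m k) (0\<^sub>m 0 m) (0\<^sub>m 0 k)"
      unfolding S_def using that
      by (subst mult_four_block_mat[where ?n1.0=m and ?n2.0=0]) auto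
    finally show ?thesis .
  qed
  have UX: "U' * X = four_block_mat X (0\<^sub>m m 0) (U * X) (0\<^sub>m k 0)"
    if "X \<in> carrier_mat m m" for X
  proof -
    have "U' * X = U' * four_block_mat X (0\<^sub>m m 0) (0\<^sub>m 0 m) (0\<^sub>m 0 0)" by (simp only: fb[OF that])
    also have "\<dots> = four_block_mat X (0\<^sub>m m 0) (U * X) (0\<^sub>m k 0)"
      unfolding U'_def using that
      by (subst mult_four_block_mat[where ?n1.0=m and ?n2.0=0]) auto
    finally show ?thesis .
  qed
  have SU: "S * U' = 1\<^sub>m m"
    unfolding S_def U'_def
    by (subst mult_four_block_mat[where ?n1.0=m and ?n2.0=k]) (auto simp: fb)
  have SJ: "S * J = 1\<^sub>m m"
    unfolding S_def J_def
    by (subst mult_four_block_mat[where ?n1.0=m and ?n2.0=k]) (auto simp: fb)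
  have SK: "S * K = B1 * S"
    unfolding XS[OF car(1)] unfolding S_def K_def
    by (subst mult_four_block_mat[where ?n1.0=m and ?n2.0=k]) auto
  have SA: "S * ?A = B2 * S + R'"
    unfolding XS[OF car(2)] unfolding S_def R'_def
    by (subst add_four_block_mat[of _ m m _ k _ 0], simp_all)
       (subst mult_four_block_mat[where ?n1.0=m and ?n2.0=k], auto)
  have detK: "det K = det B1"
    unfolding K_def by (subst det_four_block_mat_lower_left_zero[of _ m _ k]) auto
  have AK: "?A * K = four_block_mat ((B2 + W2) * B1) R (U * W2 * B1) A"
    unfolding K_def
    by (subst mult_four_block_mat[where ?n1.0=m and ?n2.0=k]) auto
  have UWBS: "U' * W1 * (B2 * S)
    = four_block_mat (W1 * B2) (0\<^sub>m m k) (U * W1 * B2) (0\<^sub>m k k)"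
    unfolding XS[OF car(2)] UX[OF car(3)]
    by (subst mult_four_block_mat[where ?n1.0=m and ?n2.0=0]) auto
  have "W1 * B2 + (B2 + W2) * B1 = B1 * B2 + W"
    unfolding W_def comm by (rule eq_matI) (auto simp: add_mult_distrib_mat[of _ m m _ _ m])
  moreover have "U * W1 * B2 + U * W2 * B1 = U * W"
    unfolding W_def
    by (subst mult_add_distrib_mat[of _ k m _ m]) (auto simp: assoc_mult_mat[of _ k m _ m _ m])
  ultimately have "U' * W1 * (B2 * S) + ?A * K = four_block_mat (B1 * B2 + W) R (U * W) A"
    unfolding AK UWBS
    by (subst add_four_block_mat[of _ m m _ k _ k]) auto
  with split_off_identity_block[OF car(1,2,3,5,6) m_car(1,2,6,3,4,5) comm bezout detK det SU SJ SK SA]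
  show ?thesis by simp
qed

section \<open>Block diagonal matrices with a repeated block row\<close>

definition rank_update ::
  "nat \<Rightarrow> ('i \<Rightarrow> 'a :: semiring_1 mat) \<Rightarrow> ('i \<Rightarrow> 'a mat) \<Rightarrow> 'i list \<Rightarrow> 'a mat" where
  "rank_update m B W is = diag_block_mat (map B is) +
     (ones_col (length is) \<otimes>\<^sub>m 1\<^sub>m m) * block_row m (map W is)"

text \<open>For commuting invertible \<open>B i\<close> this is the numerator of \<open>1 + (\<Sum>i. W i * inverse (B i))\<close> over the
common denominator given by the product of all \<open>B i\<close>.\<close>

definition secular_numerator ::
  "nat \<Rightarrow> ('i \<Rightarrow> 'a :: semiring_1 mat) \<Rightarrow> ('i \<Rightarrow> 'a mat) \<Rightarrow> 'i list \<Rightarrow> 'a mat" where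
  "secular_numerator m B W is = mat_prod m B is +
     mat_sum m (\<lambda>i. W i * mat_prod m B (filter (\<lambda>j. j \<noteq> i) is)) (set is)"

text \<open>This and the corresponding lemma for block rows peel off the first block, in the four-block form
with empty blocks that \<open>merge_two_blocks\<close> uses.\<close>

lemma kronecker_ones_col_Suc:
  "ones_col (Suc k) \<otimes>\<^sub>m 1\<^sub>m m =
     four_block_mat (1\<^sub>m m) (0\<^sub>m m 0) (ones_col k \<otimes>\<^sub>m 1\<^sub>m m) (0\<^sub>m (k * m) 0 :: 'a :: semiring_1 mat)"
proof (rule eq_matI, goal_cases)
  case (1 i j)
  then have ij: "i < m + k * m" "j < m" by (auto simp: kronecker_def ones_col_def)
  then have m: "m > 0" by simp
  have "i div m < Suc k" using ij m by (simp add: less_mult_imp_div_less)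
  moreover have "(i - m) div m < k" "(i - m) mod m = i mod m" if "\<not> i < m"
    using that ij m by (auto simp: le_mod_geq intro!: less_mult_imp_div_less)
  ultimately show ?case using ij m
    by (auto simp: kronecker_def ones_col_def)
qed (auto simp: kronecker_def ones_col_def)

lemma kronecker_ones_col_carrier [simp]: "ones_col k \<otimes>\<^sub>m 1\<^sub>m m \<in> carrier_mat (k * m) m"
  by (simp add: kronecker_def ones_col_def)

lemma block_row_Nil: "block_row m [] = 0\<^sub>m m 0"
  by (rule eq_matI) (auto simp: block_row_def)

lemma block_row_Cons:
  assumes "M \<in> carrier_mat m m" "block_row m Ms \<in> carrier_mat m k"
  shows "block_row m (M # Ms) = four_block_mat M (block_row m Ms) (0\<^sub>m 0 m) (0\<^sub>m 0 k)"
proof (rule eq_matI, goal_cases)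
  case (1 i j)
  then show ?case using assms
    by (auto simp: block_row_def mat_of_cols_index nth_append)
qed (use assms in \<open>auto simp: block_row_def\<close>)

lemma block_row_carrier:
  assumes "\<And>M. M \<in> set Ms \<Longrightarrow> (M :: 'a :: zero mat) \<in> carrier_mat m m"
  shows "block_row m Ms \<in> carrier_mat m (length Ms * m)"
  using assms
proof (induction Ms)
  case Nil
  show ?case by (simp add: block_row_Nil)
next
  case (Cons M Ms)
  then show ?case
    using four_block_carrier_mat[of M m m "0\<^sub>m 0 (length Ms * m)" 0 "length Ms * m"]
    by (simp add: block_row_Cons)
qed

lemma diag_block_carrier:
  assumes "\<And>M. M \<in> set Ms \<Longrightarrow> M \<in> carrier_mat m m"
  shows "diag_block_mat Ms \<in> carrier_mat (length Ms * m) (length Ms * m)"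
  using assms
proof (induction Ms)
  case (Cons M Ms)
  then show ?case by (simp add: Let_def)
qed simp

lemma rank_update_carrier:
  assumes "\<And>i. i \<in> set is \<Longrightarrow> B i \<in> carrier_mat m m"
    and "\<And>i. i \<in> set is \<Longrightarrow> W i \<in> carrier_mat m m"
  shows "rank_update m B W is \<in> carrier_mat (length is * m) (length is * m)"
proof -
  have "block_row m (map W is) \<in> carrier_mat m (length is * m)"
    using block_row_carrier[of "map W is" m] assms by auto
  then show ?thesis
    using diag_block_carrier[of "map B is" m] assms
    unfolding rank_update_def
    by (intro add_carrier_mat mult_carrier_mat[OF kronecker_ones_col_carrier])
qed

lemma rank_update_Cons:
  fixes B W :: "'i \<Rightarrow> 'a :: comm_ring_1 mat"
  assumes B: "\<And>j. j \<in> set (i # is) \<Longrightarrow> B j \<in> carrier_mat m m"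
    and W: "\<And>j. j \<in> set (i # is) \<Longrightarrow> W j \<in> carrier_mat m m"
  shows "rank_update m B W (i # is) =
    four_block_mat (B i + W i) (block_row m (map W is))
      ((ones_col (length is) \<otimes>\<^sub>m 1\<^sub>m m) * W i) (rank_update m B W is)"
proof -
  let ?k = "length is * m"
  have D: "diag_block_mat (map B is) \<in> carrier_mat ?k ?k"
    using diag_block_carrier[of "map B is" m] B by auto
  have R: "block_row m (map W is) \<in> carrier_mat m ?k"
    using block_row_carrier[of "map W is" m] W by auto
  have BW: "B i \<in> carrier_mat m m" "W i \<in> carrier_mat m m" using B W by auto
  have [simp]: "(ones_col (length is) \<otimes>\<^sub>m 1\<^sub>m m) * W i \<in> carrier_mat ?k m"
      "(ones_col (length is) \<otimes>\<^sub>m 1\<^sub>m m) * block_row m (map W is) \<in> carrier_mat ?k ?k"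
    using mult_carrier_mat[OF kronecker_ones_col_carrier] R BW by blast+
  note [simp] = D R BW D[THEN carrier_matD(1)] R[THEN carrier_matD(1)] BW[THEN carrier_matD(1)]
    D[THEN carrier_matD(2)] R[THEN carrier_matD(2)] BW[THEN carrier_matD(2)]
  have UR: "(ones_col (length (i # is)) \<otimes>\<^sub>m 1\<^sub>m m) * block_row m (map W (i # is)) =
    four_block_mat (W i) (block_row m (map W is)) ((ones_col (length is) \<otimes>\<^sub>m 1\<^sub>m m) * W i)
      ((ones_col (length is) \<otimes>\<^sub>m 1\<^sub>m m) * block_row m (map W is))"
    unfolding list.map length_Cons kronecker_ones_col_Suc block_row_Cons[OF BW(2) R]
    by (subst mult_four_block_mat[where ?n1.0=m and ?n2.0=0]) auto
  have DD: "diag_block_mat (map B (i # is)) =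
    four_block_mat (B i) (0\<^sub>m m ?k) (0\<^sub>m ?k m) (diag_block_mat (map B is))"
    by (simp add: Let_def)
  show ?thesis
    unfolding rank_update_def UR DD
    by (subst add_four_block_mat[of _ m m _ ?k _ ?k]) auto
qed

text \<open>The merged data replace those at index \<open>j\<close>, and \<open>i\<close> leaves the index list; thus the result is again
of the form \<open>rank_update\<close>, over a shorter list.\<close>

lemma rank_update_merge:
  fixes B W :: "'i \<Rightarrow> 'a :: idom mat"
  assumes j: "j \<notin> set is"
    and B: "\<And>l. l \<in> set (i # j # is) \<Longrightarrow> B l \<in> carrier_mat m m"
    and W: "\<And>l. l \<in> set (i # j # is) \<Longrightarrow> W l \<in> carrier_mat m m"
    and bez: "\<alpha> \<in> carrier_mat m m" "\<beta> \<in> carrier_mat m m" "B i * \<alpha> + B j * \<beta> = 1\<^sub>m m"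
    and comm: "B i * B j = B j * B i"
    and det: "det (B i) \<noteq> 0"
  defines "N \<equiv> m + length is * m"
  shows "\<exists>E \<in> carrier_mat (m + N) (m + N). \<exists>F \<in> carrier_mat (m + N) (m + N).
    det E = 1 \<and> det F = 1 \<and>
    E * rank_update m B W (i # j # is) * F =
      four_block_mat (1\<^sub>m m) (0\<^sub>m m N) (0\<^sub>m N m)
        (rank_update m (B(j := B i * B j)) (W(j := W i * B j + W j * B i)) (j # is))"
proof -
  let ?B = "B(j := B i * B j)" and ?W = "W(j := W i * B j + W j * B i)"
  let ?U = "ones_col (length is) \<otimes>\<^sub>m 1\<^sub>m m :: 'a mat"
  let ?R = "block_row m (map W is)" and ?A = "rank_update m B W is"
  have car: "B i \<in> carrier_mat m m" "B j \<in> carrier_mat m m"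
    "W i \<in> carrier_mat m m" "W j \<in> carrier_mat m m"
    using B W by auto
  have merged_car: "B i * B j \<in> carrier_mat m m" "W i * B j + W j * B i \<in> carrier_mat m m"
    using car mult_carrier_mat by auto
  have R: "?R \<in> carrier_mat m (length is * m)"
    using block_row_carrier[of "map W is" m] W by auto
  have A: "?A \<in> carrier_mat (length is * m) (length is * m)"
    using B W by (intro rank_update_carrier) auto
  have upd: "map ?B is = map B is" "map ?W is = map W is" using j by auto
  have upd_A: "rank_update m ?B ?W is = ?A" unfolding rank_update_def upd ..
  have "rank_update m B W (j # is) = four_block_mat (B j + W j) ?R (?U * W j) ?A"
    by (rule rank_update_Cons) (use B W in auto)
  moreover have "rank_update m B W (i # j # is) = four_block_mat (B i + W i)
    (block_row m (map W (j # is))) ((ones_col (length (j # is)) \<otimes>\<^sub>m 1\<^sub>m m) * W i)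
    (rank_update m B W (j # is))"
    by (rule rank_update_Cons) (use B W in auto)
  ultimately have before: "rank_update m B W (i # j # is) =
    four_block_mat (B i + W i) (four_block_mat (W j) ?R (0\<^sub>m 0 m) (0\<^sub>m 0 (length is * m)))
      (four_block_mat (1\<^sub>m m) (0\<^sub>m m 0) ?U (0\<^sub>m (length is * m) 0) * W i)
      (four_block_mat (B j + W j) ?R (?U * W j) ?A)"
    by (simp add: block_row_Cons[OF car(4) R] kronecker_ones_col_Suc)
  have "rank_update m ?B ?W (j # is) = four_block_mat (?B j + ?W j)
    (block_row m (map ?W is)) (?U * ?W j) (rank_update m ?B ?W is)"
    by (rule rank_update_Cons) (use B W merged_car in auto)
  then have after: "rank_update m ?B ?W (j # is) =
    four_block_mat (B i * B j + (W i * B j + W j * B i)) ?R (?U * (W i * B j + W j * B i)) ?A"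
    unfolding upd_A upd by simp
  show ?thesis
    unfolding before after N_def
    by (rule merge_two_blocks[OF car bez(1,2) kronecker_ones_col_carrier R A comm bez(3) det])
qed

section \<open>Invariance of the numerator\<close>

lemma mat_sum_insert:
  fixes f :: "'i \<Rightarrow> 'a :: comm_ring_1 mat"
  assumes "finite I" "i \<notin> I" "\<And>j. j \<in> insert i I \<Longrightarrow> f j \<in> carrier_mat m m"
  shows "mat_sum m f (insert i I) = f i + mat_sum m f I"
proof -
  interpret ring "ring_mat TYPE('a) m ()" by (rule ring_mat)
  show ?thesis
    unfolding mat_sum_def using assms
    by (subst finsum_insert) (auto simp: ring_mat_simps)
qed

lemma mat_sum_empty: "mat_sum m f {} = (0\<^sub>m m m :: 'a :: comm_ring_1 mat)"
proof -
  interpret ring "ring_mat TYPE('a) m ()" by (rule ring_mat)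
  show ?thesis unfolding mat_sum_def by (simp add: ring_mat_simps)
qed

lemma mat_sum_carrier:
  fixes f :: "'i \<Rightarrow> 'a :: comm_ring_1 mat"
  assumes "\<And>j. j \<in> I \<Longrightarrow> f j \<in> carrier_mat m m"
  shows "mat_sum m f I \<in> carrier_mat m m"
proof -
  interpret ring "ring_mat TYPE('a) m ()" by (rule ring_mat)
  show ?thesis
    unfolding mat_sum_def using assms finsum_closed[of f I]
    by (auto simp: ring_mat_simps)
qed

lemma mat_sum_cong:
  fixes f :: "'i \<Rightarrow> 'a :: comm_ring_1 mat"
  assumes "\<And>j. j \<in> I \<Longrightarrow> f j = g j" "\<And>j. j \<in> I \<Longrightarrow> g j \<in> carrier_mat m m"
  shows "mat_sum m f I = mat_sum m g I"
proof -
  interpret ring "ring_mat TYPE('a) m ()" by (rule ring_mat)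
  show ?thesis
    unfolding mat_sum_def
    by (rule finsum_cong') (use assms in \<open>auto simp: ring_mat_simps\<close>)
qed

lemma mat_prod_Cons: "mat_prod m f (i # is) = f i * mat_prod m f is"
  by (simp add: mat_prod_def)

lemma mat_prod_cong:
  assumes "\<And>i. i \<in> set is \<Longrightarrow> f i = g i"
  shows "mat_prod m f is = mat_prod m g is"
  using assms by (simp add: mat_prod_def cong: map_cong)

lemma mat_prod_carrier:
  assumes "\<And>i. i \<in> set is \<Longrightarrow> f i \<in> carrier_mat m m"
  shows "mat_prod m f is \<in> carrier_mat m m"
  using assms by (induction "is") (auto simp: mat_prod_def intro: mult_carrier_mat)

lemma secular_numerator_carrier:
  fixes B W :: "'i \<Rightarrow> 'a :: comm_ring_1 mat"
  assumes "\<And>i. i \<in> set is \<Longrightarrow> B i \<in> carrier_mat m m"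
    and "\<And>i. i \<in> set is \<Longrightarrow> W i \<in> carrier_mat m m"
  shows "secular_numerator m B W is \<in> carrier_mat m m"
  unfolding secular_numerator_def
  by (intro add_carrier_mat mat_sum_carrier mult_carrier_mat[of _ m m] mat_prod_carrier)
    (use assms in auto)

text \<open>In the sum over \<open>i # j # is\<close>, the terms at \<open>i\<close> and \<open>j\<close> together give the merged term at \<open>j\<close>. In
every other term \<open>B i\<close> and \<open>B j\<close> are the first two factors of the product, so that merging them is
associativity; this is why the two blocks are taken at the front of the list.\<close>

lemma secular_numerator_merge:
  fixes B W :: "'i \<Rightarrow> 'a :: comm_ring_1 mat"
  assumes dist: "distinct (i # j # is)"
    and B: "\<And>l. l \<in> set (i # j # is) \<Longrightarrow> B l \<in> carrier_mat m m"
    and W: "\<And>l. l \<in> set (i # j # is) \<Longrightarrow> W l \<in> carrier_mat m m"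
  shows "secular_numerator m (B(j := B i * B j)) (W(j := W i * B j + W j * B i)) (j # is) =
    secular_numerator m B W (i # j # is)"
proof -
  let ?B = "B(j := B i * B j)" and ?W = "W(j := W i * B j + W j * B i)"
  let ?\<Pi> = "mat_prod m B is" and ?\<Pi>' = "\<lambda>l. mat_prod m B (filter (\<lambda>k. k \<noteq> l) is)"
  let ?t = "\<lambda>l. W l * mat_prod m B (filter (\<lambda>k. k \<noteq> l) (i # j # is))"
  let ?t' = "\<lambda>l. ?W l * mat_prod m ?B (filter (\<lambda>k. k \<noteq> l) (j # is))"
  have \<Pi>: "?\<Pi> \<in> carrier_mat m m" "\<And>l. ?\<Pi>' l \<in> carrier_mat m m"
    using B by (auto intro!: mat_prod_carrier)
  have ij: "B i \<in> carrier_mat m m" "B j \<in> carrier_mat m m"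
      "W i \<in> carrier_mat m m" "W j \<in> carrier_mat m m"
    using B W by auto
  note assoc = assoc_mult_mat[of _ m m _ m _ m]
  have B_is: "mat_prod m ?B (filter Q is) = mat_prod m B (filter Q is)" for Q
    using dist by (intro mat_prod_cong) auto
  have filt: "filter (\<lambda>k. k \<noteq> l) is = is" if "l = i \<or> l = j" for l
    using that dist by (auto simp: filter_id_conv)
  have ti: "?t i = W i * (B j * ?\<Pi>)" and tj: "?t j = W j * (B i * ?\<Pi>)"
    and t'j: "?t' j = (W i * B j + W j * B i) * ?\<Pi>"
    using dist filt B_is[of "\<lambda>k. k \<noteq> j"] by (auto simp: mat_prod_Cons)
  have tl: "?t' l = ?t l" if "l \<in> set is" for l
  proof -
    have "?t' l = W l * (B i * B j * ?\<Pi>' l)" using that dist B_is by (auto simp: mat_prod_Cons)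
    also have "\<dots> = ?t l" using that dist \<Pi>(2)[of l] ij by (auto simp: mat_prod_Cons assoc)
    finally show ?thesis .
  qed
  have "mat_prod m B (filter Q (i # j # is)) \<in> carrier_mat m m" for Q
    by (rule mat_prod_carrier, rule B) (simp only: set_filter, blast)
  then have t_car: "?t l \<in> carrier_mat m m" if "l \<in> set (i # j # is)" for l
    by (intro mult_carrier_mat[of _ m m] W that)
  have t'_car: "?t' l \<in> carrier_mat m m" if "l \<in> set (j # is)" for l
  proof (cases "l = j")
    case True
    show ?thesis unfolding True t'j using ij \<Pi> by (intro mult_carrier_mat[of _ m m]) auto
  next
    case False
    then have "l \<in> set is" using that by simp
    then show ?thesis unfolding tl[OF \<open>l \<in> set is\<close>] by (intro t_car) simp
  qed
  let ?s = "mat_sum m ?t (set is)"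
  have s_car: "?s \<in> carrier_mat m m" by (rule mat_sum_carrier, rule t_car) simp
  have "mat_sum m ?t' (set (j # is)) = ?t' j + mat_sum m ?t' (set is)"
    unfolding list.set by (rule mat_sum_insert) (use dist t'_car in auto)
  also have "mat_sum m ?t' (set is) = ?s"
    by (rule mat_sum_cong, erule tl, rule t_car) simp
  also have "?t' j = ?t i + ?t j"
    unfolding ti tj t'j using ij \<Pi>
    by (simp add: add_mult_distrib_mat[of _ m m _ _ m] assoc)
  also have "?t i + ?t j + ?s = ?t i + (?t j + ?s)"
    by (rule assoc_add_mat[of _ m m]; (rule s_car | (rule t_car, simp)))
  also have "\<dots> = ?t i + mat_sum m ?t (set (j # is))"
    unfolding list.set by (subst mat_sum_insert[of _ j]) (use dist t_car in auto)
  also have "\<dots> = mat_sum m ?t (set (i # j # is))"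
    unfolding list.set by (subst mat_sum_insert[of _ i]) (use dist t_car in auto)
  finally have sums: "mat_sum m ?t' (set (j # is)) = mat_sum m ?t (set (i # j # is))" .
  have "mat_prod m ?B (j # is) = mat_prod m B (i # j # is)"
    using B_is[of "\<lambda>_. True"] ij \<Pi> by (simp add: mat_prod_Cons assoc)
  with sums show ?thesis unfolding secular_numerator_def by simp
qed

section \<open>Right co-primality of products\<close>

lemma right_coprime_sym:
  assumes "M \<in> carrier_mat m m" "M' \<in> carrier_mat m m" "right_coprime m M M'"
  shows "right_coprime m M' M"
proof -
  from assms(3) obtain \<alpha> \<beta> where ab: "\<alpha> \<in> carrier_mat m m" "\<beta> \<in> carrier_mat m m"
      "M * \<alpha> + M' * \<beta> = 1\<^sub>m m"
    unfolding right_coprime_def by blast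
  have "M' * \<beta> + M * \<alpha> = M * \<alpha> + M' * \<beta>"
    by (rule comm_add_mat[of _ m m]) (use assms ab in \<open>auto intro: mult_carrier_mat\<close>)
  then show ?thesis unfolding right_coprime_def using ab by auto
qed

text \<open>From \<open>1 = B1 * a + M * b\<close> and \<open>1 = B2 * c + M * d\<close>, insert the second identity after \<open>B1\<close> in the
first. The term \<open>B1 * M * d * a\<close> that arises is a right multiple of \<open>M\<close> because \<open>B1\<close> and \<open>M\<close>
commute.\<close>

lemma right_coprime_mult_left:
  assumes B: "B1 \<in> carrier_mat m m" "B2 \<in> carrier_mat m m" "M \<in> carrier_mat m m"
    and comm: "B1 * M = M * B1"
    and cop: "right_coprime m B1 M" "right_coprime m B2 M"
  shows "right_coprime m (B1 * B2) M"
proof -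
  from cop obtain a b c d where car: "a \<in> carrier_mat m m" "b \<in> carrier_mat m m"
      "c \<in> carrier_mat m m" "d \<in> carrier_mat m m"
    and bez: "B1 * a + M * b = 1\<^sub>m m" "B2 * c + M * d = 1\<^sub>m m"
    unfolding right_coprime_def by blast
  note [simp] = B car mult_carrier_mat[of _ m m _ m]
  have "B1 * (B2 * c + M * d) * a + M * b = 1\<^sub>m m"
    unfolding bez(2) using bez(1) by (simp add: right_mult_one_mat[OF B(1)])
  also have "B1 * (B2 * c + M * d) = B1 * B2 * c + M * B1 * d"
    unfolding comm[symmetric]
    by (simp add: mult_add_distrib_mat[of _ m m _ m] assoc_mult_mat[of _ m m _ m _ m])
  also have "(B1 * B2 * c + M * B1 * d) * a + M * b =
      B1 * B2 * (c * a) + M * (B1 * d * a + b)"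
    by (simp add: mult_add_distrib_mat[of _ m m _ m] add_mult_distrib_mat[of _ m m _ _ m]
        assoc_mult_mat[of _ m m _ m _ m] assoc_add_mat[of _ m m])
  finally show ?thesis
    unfolding right_coprime_def
    by (intro bexI[of _ "c * a"] bexI[of _ "B1 * d * a + b"]) auto
qed

section \<open>Equivalence with the numerator\<close>

text \<open>Induction on the index list for arbitrary \<open>B\<close> and \<open>W\<close>, since each merging step changes both. The
determinants of \<open>E\<close> and \<open>F\<close> come out as 1, which is stronger than unimodularity and easier to carry
through products.\<close>

lemma rank_update_equivalent_secular_numerator:
  assumes "distinct is" "is \<noteq> []"
    and "\<And>i. i \<in> set is \<Longrightarrow> B i \<in> carrier_mat m m"
    and "\<And>i. i \<in> set is \<Longrightarrow> W i \<in> carrier_mat m m"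
    and "\<And>i. i \<in> set is \<Longrightarrow> det (B i) \<noteq> 0"
    and "\<And>i j. i \<in> set is \<Longrightarrow> j \<in> set is \<Longrightarrow> B i * B j = B j * B i"
    and "\<And>i j. i \<in> set is \<Longrightarrow> j \<in> set is \<Longrightarrow> i \<noteq> j \<Longrightarrow> right_coprime m (B i) (B j)"
  shows "\<exists>E \<in> carrier_mat (length is * m) (length is * m).
    \<exists>F \<in> carrier_mat (length is * m) (length is * m). det E = 1 \<and> det F = 1 \<and>
      E * rank_update m B W is * F =
        diag_block_mat [1\<^sub>m ((length is - 1) * m), secular_numerator m B W is]"
  using assms
proof (induction "is" arbitrary: B W)
  case Nil
  then show ?case by simp
next
  case (Cons i js)
  note B = Cons.prems(3) and W = Cons.prems(4) and dets = Cons.prems(5)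
    and comm = Cons.prems(6) and cop = Cons.prems(7)
  show ?case
  proof (cases js)
    case Nil
    have [simp]: "B i \<in> carrier_mat m m" "W i \<in> carrier_mat m m" using B W by auto
    have "rank_update m B W [i] = B i + W i"
      by (subst rank_update_Cons)
         (auto simp: block_row_Nil rank_update_def kronecker_def ones_col_def intro!: eq_matI)
    moreover have "secular_numerator m B W [i] = B i + W i"
      using mat_sum_insert[of "{}" i "\<lambda>_. W i" m]
        mat_sum_cong[of "{i}" "\<lambda>l. W l * mat_prod m B (filter (\<lambda>k. k \<noteq> l) [i])" "\<lambda>_. W i" m]
      by (simp add: secular_numerator_def mat_prod_def mat_sum_empty right_mult_one_mat[of _ m m])
    moreover have "1\<^sub>m m * (B i + W i) * 1\<^sub>m m = B i + W i"
      by (simp add: left_mult_one_mat[of _ m m] right_mult_one_mat[of _ m m])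
    \<comment> \<open>The identity block in the normal form is empty for a single index.\<close>
    moreover have "four_block_mat (1\<^sub>m 0) (0\<^sub>m 0 m) (0\<^sub>m m 0) (B i + W i) = B i + W i"
      by (rule eq_matI) (auto simp: carrier_matD[of "B i" m m] carrier_matD[of "W i" m m])
    ultimately show ?thesis using Nil
      by (intro bexI[of _ "1\<^sub>m m"]) (auto simp: carrier_matD[of "W i" m m])
  next
    case (Cons j "is")
    let ?B = "B(j := B i * B j)" and ?W = "W(j := W i * B j + W j * B i)"
    let ?N = "m + length is * m"
    let ?P = "secular_numerator m B W (i # js)"
    have dist: "i \<noteq> j" "i \<notin> set is" "j \<notin> set is" using Cons Cons.prems(1) by auto
    have car: "B i \<in> carrier_mat m m" "B j \<in> carrier_mat m m"
      "W i \<in> carrier_mat m m" "W j \<in> carrier_mat m m"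
      using B W Cons by auto
    have merged_car: "B i * B j \<in> carrier_mat m m" "W i * B j + W j * B i \<in> carrier_mat m m"
      using car mult_carrier_mat by auto
    obtain \<alpha> \<beta> where bez: "\<alpha> \<in> carrier_mat m m" "\<beta> \<in> carrier_mat m m"
      "B i * \<alpha> + B j * \<beta> = 1\<^sub>m m"
      using cop[of i j] dist Cons unfolding right_coprime_def by auto
    obtain E1 F1 where EF1: "E1 \<in> carrier_mat (m + ?N) (m + ?N)" "F1 \<in> carrier_mat (m + ?N) (m + ?N)"
      "det E1 = 1" "det F1 = 1"
      and eq1: "E1 * rank_update m B W (i # js) * F1 =
        four_block_mat (1\<^sub>m m) (0\<^sub>m m ?N) (0\<^sub>m ?N m) (rank_update m ?B ?W js)"
      using rank_update_merge[of j "is" i B m W \<alpha> \<beta>, OF _ _ _ bez] B W dist dets comm Cons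
      by auto
    have "\<exists>E \<in> carrier_mat (length js * m) (length js * m).
      \<exists>F \<in> carrier_mat (length js * m) (length js * m). det E = 1 \<and> det F = 1 \<and>
        E * rank_update m ?B ?W js * F =
          diag_block_mat [1\<^sub>m ((length js - 1) * m), secular_numerator m ?B ?W js]"
    proof (rule Cons.IH)
      show "distinct js" "js \<noteq> []" using Cons.prems(1) Cons by auto
      show "?B l \<in> carrier_mat m m" "?W l \<in> carrier_mat m m" if "l \<in> set js" for l
        using that B W merged_car by auto
      show "det (?B l) \<noteq> 0" if "l \<in> set js" for l
        using that dets Cons det_mult[OF car(1,2)] by auto
      have prod_comm: "B i * B j * B l = B l * (B i * B j)" if "l \<in> set (i # js)" for l
      proof -
        have l: "B l \<in> carrier_mat m m" using that B by auto
        have "B i * B j * B l = B i * (B l * B j)"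
          using comm[of j l] that Cons by (simp add: assoc_mult_mat[OF car(1,2) l])
        also have "\<dots> = B l * B i * B j"
          using comm[of i l] that Cons by (simp add: assoc_mult_mat[OF car(1) l car(2), symmetric])
        finally show ?thesis by (simp add: assoc_mult_mat[OF l car(1,2)])
      qed
      show "?B k * ?B l = ?B l * ?B k" if "k \<in> set js" "l \<in> set js" for k l
        using that comm prod_comm[of k] prod_comm[of l] by auto
      have prod_cop: "right_coprime m (B i * B j) (B l)" if "l \<in> set is" for l
        using that dist Cons B comm cop car
        by (intro right_coprime_mult_left) auto
      have prod_cop': "right_coprime m (B l) (B i * B j)" if "l \<in> set is" for l
        using that prod_cop B Cons merged_car by (intro right_coprime_sym[OF _ _ prod_cop]) auto
      show "right_coprime m (?B k) (?B l)" if "k \<in> set js" "l \<in> set js" "k \<noteq> l" for k l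
        using that cop prod_cop prod_cop' Cons by auto
    qed
    moreover have "secular_numerator m ?B ?W js = ?P"
      unfolding Cons
      by (rule secular_numerator_merge) (use Cons.prems(1) B W Cons in auto)
    moreover have len: "length js * m = ?N" "length (i # js) * m = m + ?N"
        "(length js - 1) * m = length is * m" "(length (i # js) - 1) * m = ?N"
      using Cons by simp_all
    ultimately obtain E2 F2 where EF2: "E2 \<in> carrier_mat ?N ?N" "F2 \<in> carrier_mat ?N ?N"
        "det E2 = 1" "det F2 = 1"
      and eq2: "E2 * rank_update m ?B ?W js * F2 = diag_block_mat [1\<^sub>m (length is * m), ?P]"
      by auto
    \<comment> \<open>The transformations of the smaller matrix, extended by the identity on the block split off.\<close>
    let ?Z = "four_block_mat (1\<^sub>m m) (0\<^sub>m m ?N) (0\<^sub>m ?N m)"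
    have P: "?P \<in> carrier_mat m m" using B W by (intro secular_numerator_carrier)
    have Ai: "rank_update m B W (i # js) \<in> carrier_mat (m + ?N) (m + ?N)"
      unfolding len(2)[symmetric] by (rule rank_update_carrier) (use B W in auto)
    have Aj: "rank_update m ?B ?W js \<in> carrier_mat ?N ?N"
      unfolding len(1)[symmetric] by (rule rank_update_carrier) (use B W merged_car in auto)
    have Z_car: "?Z E2 \<in> carrier_mat (m + ?N) (m + ?N)" "?Z F2 \<in> carrier_mat (m + ?N) (m + ?N)"
      using EF2 by auto
    have "?Z E2 * E1 * rank_update m B W (i # js) * (F1 * ?Z F2)
        = ?Z E2 * (E1 * rank_update m B W (i # js) * F1) * ?Z F2"
      using Z_car EF1 Ai
      by (simp add: assoc_mult_mat[of _ "m + ?N" "m + ?N" _ "m + ?N" _ "m + ?N"])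
    also have "\<dots> = ?Z (E2 * rank_update m ?B ?W js * F2)"
      unfolding eq1 using EF2 Aj
      by (simp add: mult_diag_blocks mult_carrier_mat[of _ ?N ?N _ ?N])
    also have "\<dots> = diag_block_mat [1\<^sub>m (m + length is * m), ?P]"
      unfolding eq2
      using assoc_four_block_mat[of "1\<^sub>m m" "1\<^sub>m (length is * m)" ?P] P
      by (simp add: diag_block_mat_pair[OF one_carrier_mat P] add.commute[of _ m] del: diag_block_mat.simps)
    finally have eq: "?Z E2 * E1 * rank_update m B W (i # js) * (F1 * ?Z F2) =
        diag_block_mat [1\<^sub>m ((length (i # js) - 1) * m), ?P]" using len by simp
    have "det (?Z M) = det M" if "M \<in> carrier_mat ?N ?N" for M :: "complex poly mat"
      using that by (subst det_four_block_mat_upper_right_zero[of _ m _ ?N]) auto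
    then have "det (?Z E2) = 1" "det (?Z F2) = 1"
      using EF2 by simp_all
    then have "det (?Z E2 * E1) = 1" "det (F1 * ?Z F2) = 1"
      using det_mult[OF Z_car(1) EF1(1)] det_mult[OF EF1(2) Z_car(2)] EF1 by auto
    with eq show ?thesis
      unfolding len(2) using Z_car EF1
      by (intro bexI[of _ "?Z E2 * E1"] bexI[of _ "F1 * ?Z F2"]) auto
  qed
qed

lemma mat_eq_if_diff_zero:
  fixes X :: "'a :: ab_group_add mat"
  assumes "X \<in> carrier_mat m n" "Y \<in> carrier_mat m n" "X - Y = 0\<^sub>m m n"
  shows "X = Y"
proof (rule eq_matI)
  fix k l assume kl: "k < dim_row Y" "l < dim_col Y"
  have "(X - Y) $$ (k, l) = 0"
    unfolding assms(3) using assms(2) kl by auto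
  then show "X $$ (k, l) = Y $$ (k, l)" using kl by simp
qed (use assms in auto)

theorem theorem2p5:
  fixes m n q :: nat
    and Pc :: "nat \<Rightarrow> complex mat"
    and P D A :: "complex poly mat"
    and B W C :: "nat \<Rightarrow> complex poly mat"
  assumes "\<And>i. i \<le> n \<Longrightarrow> Pc i \<in> carrier_mat m m"
    and "P = mat_poly m n Pc"
    and "Pc n \<noteq> 0\<^sub>m m m"
    and "regular P"
    and "0 < q" and "q \<le> n"
    and "\<And>i. i \<in> {1..q} \<Longrightarrow> B i \<in> carrier_mat m m"
    and "\<And>i. i \<in> {1..q} \<Longrightarrow> W i \<in> carrier_mat m m"
    and "\<And>i. i \<in> {1..q} \<Longrightarrow> C i = mat_prod m B (filter (\<lambda>j. j \<noteq> i) [1..<Suc q])"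
    and "P = mat_prod m B [1..<Suc q] + mat_sum m (\<lambda>i. W i * C i) {1..q}"
    and "\<And>i. i \<in> {1..q} \<Longrightarrow> regular (B i)"
    and "\<And>i j. i \<in> {1..q} \<Longrightarrow> j \<in> {1..q} \<Longrightarrow> B i * B j - B j * B i = 0\<^sub>m m m"
    and "\<And>i j. i \<in> {1..q} \<Longrightarrow> j \<in> {1..q} \<Longrightarrow> i \<noteq> j \<Longrightarrow> right_coprime m (B i) (B j)"
    and "D = diag_block_mat (map B [1..<Suc q])"
    and "A = D + (ones_col q \<otimes>\<^sub>m 1\<^sub>m m) * block_row m (map W [1..<Suc q])"
  shows "equivalent_mat_poly m q A P"
proof -
  let ?is = "[1..<Suc q]"
  note B = assms(7) and W = assms(8)
  have set_is: "set ?is = {1..q}" and len: "length ?is = q" by auto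
  have A: "A = rank_update m B W ?is"
    unfolding assms(14,15) rank_update_def len ..
  have "mat_sum m (\<lambda>i. W i * C i) {1..q} =
      mat_sum m (\<lambda>i. W i * mat_prod m B (filter (\<lambda>j. j \<noteq> i) ?is)) {1..q}"
    by (rule mat_sum_cong)
      (use assms(9) B W in \<open>auto intro!: mult_carrier_mat[of _ m m] mat_prod_carrier\<close>)
  then have P: "P = secular_numerator m B W ?is"
    unfolding assms(10) secular_numerator_def set_is by simp
  have comm: "B i * B j = B j * B i" if ij: "i \<in> {1..q}" "j \<in> {1..q}" for i j
  proof -
    have car: "B i * B j \<in> carrier_mat m m" "B j * B i \<in> carrier_mat m m"
      using B ij by (auto intro: mult_carrier_mat)
    show ?thesis by (rule mat_eq_if_diff_zero[OF car assms(12)[OF ij]])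
  qed
  have "\<exists>E \<in> carrier_mat (q * m) (q * m). \<exists>F \<in> carrier_mat (q * m) (q * m).
      det E = 1 \<and> det F = 1 \<and> E * A * F = diag_block_mat [1\<^sub>m ((q - 1) * m), P]"
    unfolding A P using rank_update_equivalent_secular_numerator[of ?is B m W] assms(5,11,13) B W comm
    unfolding set_is len regular_def by auto
  moreover have "unimodular E" if "E \<in> carrier_mat (q * m) (q * m)" "det E = 1" for E
    using that unfolding unimodular_def by (intro conjI exI[of _ 1]) (auto simp: one_pCons)
  moreover have "A \<in> carrier_mat (q * m) (q * m)"
    unfolding A using rank_update_carrier[of ?is B m W, unfolded set_is len, OF B W] .
  moreover have "P \<in> carrier_mat m m"
    unfolding P by (rule secular_numerator_carrier) (use B W in auto)
  ultimately show ?thesis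
    unfolding equivalent_mat_poly_def by (metis mult.commute)
qed

end
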